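(* There exists a numerical constant $C>0$ such that for every integer $n\ge2$ and every $\rho_n\in(0,1]$, $$\inf_{\widehat{\boldsymbol\Theta}}\ \sup_{\boldsymbol\Theta_0\in\mathcal T[2,\rho_n]}\mathbb E_{\boldsymbol\Theta_0}\big[\|\widehat{\boldsymbol\Theta}-\boldsymbol\Theta_0\|_\square\big]\ \ge\ C\min\left(\sqrt{\frac{\rho_n}{n}},\ \rho_n\right),$$ where the infimum is over all estimators, i.e. all $\mathbb R^{n\times n}$-valued functions $\widehat{\boldsymbol\Theta}=\widehat{\boldsymbol\Theta}(\boldsymbol A)$ of the adjacency matrix.
   Context: $[m]=\{1,\dots,m\}$. For $2\le k\le n$, $\mathcal T[k]$ is the set of $n\times n$ matrices $\boldsymbol\Theta$ for which there exist a map $z:[n]\to[k]$ and a symmetric matrix $\boldsymbol Q\in[0,1]^{k\times k}$ with $\boldsymbol\Theta_{ij}=\boldsymbol Q_{z(i)z(j)}$ for $i\ne j$ and $\boldsymbol\Theta_{ii}=0$ for all $i$. $\mathcal T[k,\rho_n]=\{\boldsymbol\Theta\in\mathcal T[k]:\ \|\boldsymbol\Theta\|_\infty\le\rho_n\}$, with $\|\boldsymbol\Theta\|_\infty=\max_{i,j}|\boldsymbol\Theta_{ij}|$. Inhomogeneous random graph model with respect to $\boldsymbol\Theta_0$: $\boldsymbol A$ is a random symmetric $\{0,1\}$-valued $n\times n$ matrix with zero diagonal whose entries $\boldsymbol A_{ij}$, $i<j$, are independent Bernoulli variables with parameters $(\boldsymbol\Theta_0)_{ij}$; $\mathbb E_{\boldsymbol\Theta_0}$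 is the corresponding expectation. For $\boldsymbol B\in\mathbb R^{n\times n}$, $\|\boldsymbol B\|_\square=\frac1{n^2}\max_{S,T\subset[n]}\big|\sum_{i\in S,j\in T}\boldsymbol B_{ij}\big|$. *)

theory Defs
  imports "HOL-Probability.Probability" "HOL-Probability.Product_PMF" "Jordan_Normal_Form.Matrix"
begin

(* Matrix and vector indices start at 0, so [m] is represented by {..<m}. *)

definition block_matrices :: "nat \<Rightarrow> nat \<Rightarrow> real mat set" where
  "block_matrices n k =
     {\<Theta> \<in> carrier_mat n n.
        \<exists>z \<in> {..<n} \<rightarrow> {..<k}. \<exists>Q \<in> carrier_mat k k.
          Q\<^sup>T = Q \<and>
          (\<forall>a<k. \<forall>b<k. Q $$ (a, b) \<in> {0..1}) \<and>
          (\<forall>i<n. \<forall>j<n. i \<noteq> j \<longrightarrow> \<Theta> $$ (i, j) = Q $$ (z i, z j)) \<and>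
          (\<forall>i<n. \<Theta> $$ (i, i) = 0)}"

definition max_norm :: "nat \<Rightarrow> real mat \<Rightarrow> real" where
  "max_norm n B = Max ((\<lambda>(i, j). \<bar>B $$ (i, j)\<bar>) ` ({..<n} \<times> {..<n}))"

definition sparse_block_matrices :: "nat \<Rightarrow> nat \<Rightarrow> real \<Rightarrow> real mat set" where
  "sparse_block_matrices n k \<rho> = {\<Theta> \<in> block_matrices n k. max_norm n \<Theta> \<le> \<rho>}"

definition cut_norm :: "nat \<Rightarrow> real mat \<Rightarrow> real" where
  "cut_norm n B =
     1 / (real n)\<^sup>2 *
     Max ((\<lambda>(S, T). \<bar>\<Sum>i\<in>S. \<Sum>j\<in>T. B $$ (i, j)\<bar>) ` (Pow {..<n} \<times> Pow {..<n}))"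

definition adjacency_matrices :: "nat \<Rightarrow> real mat set" where
  "adjacency_matrices n =
     {A \<in> carrier_mat n n. A\<^sup>T = A \<and>
        (\<forall>i<n. \<forall>j<n. A $$ (i, j) \<in> {0, 1}) \<and> (\<forall>i<n. A $$ (i, i) = 0)}"

definition edge_slots :: "nat \<Rightarrow> (nat \<times> nat) set" where
  "edge_slots n = {(i, j). i < j \<and> j < n}"

definition adjacency_of_edges :: "nat \<Rightarrow> (nat \<times> nat \<Rightarrow> bool) \<Rightarrow> real mat" where
  "adjacency_of_edges n e =
     mat n n (\<lambda>(i, j). if i < j then of_bool (e (i, j))
                       else if j < i then of_bool (e (j, i)) else 0)"

(* The law of the adjacency matrix. Only the values \<Theta> $$ (i, j) with i < j < n are used. *)
definition random_graph :: "nat \<Rightarrow> real mat \<Rightarrow> real mat pmf" where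
  "random_graph n \<Theta> =
     map_pmf (adjacency_of_edges n)
       (Pi_pmf (edge_slots n) False (\<lambda>(i, j). bernoulli_pmf (\<Theta> $$ (i, j))))"

definition estimators :: "nat \<Rightarrow> (real mat \<Rightarrow> real mat) set" where
  "estimators n = adjacency_matrices n \<rightarrow> carrier_mat n n"

(* The expectation is always finite, since the law has finite support; the extended reals
   only serve to make the infimum and supremum those of a complete lattice. *)
definition minimax_cut_risk :: "nat \<Rightarrow> real mat set \<Rightarrow> ereal" where
  "minimax_cut_risk n \<T> =
     (INF est \<in> estimators n. SUP \<Theta> \<in> \<T>.
        ereal (measure_pmf.expectation (random_graph n \<Theta>) (\<lambda>A. cut_norm n (est A - \<Theta>))))"

lemma finite_edge_slots: "finite (edge_slots n)"
  by (rule finite_subset[of _ "{..<n} \<times> {..<n}"]) (auto simp: edge_slots_def)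

lemma adjacency_of_edges_index:
  "(i, j) \<in> edge_slots n \<Longrightarrow> adjacency_of_edges n e $$ (i, j) = of_bool (e (i, j))"
  by (auto simp: adjacency_of_edges_def edge_slots_def)

lemma finite_set_random_graph: "finite (set_pmf (random_graph n \<Theta>))"
proof -
  have "finite (set_pmf (Pi_pmf (edge_slots n) False (\<lambda>(i, j). bernoulli_pmf (\<Theta> $$ (i, j)))))"
    by (subst set_Pi_pmf[OF finite_edge_slots])
       (intro finite_PiE_dflt finite_edge_slots finite)
  thus ?thesis by (simp add: random_graph_def)
qed

lemma set_random_graph: "set_pmf (random_graph n \<Theta>) \<subseteq> adjacency_matrices n"
  by (auto simp: random_graph_def adjacency_of_edges_def adjacency_matrices_def intro!: eq_matI)

lemma random_graph_entry:
  assumes "(i, j) \<in> edge_slots n"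
  shows "map_pmf (\<lambda>A. A $$ (i, j)) (random_graph n \<Theta>) =
           map_pmf of_bool (bernoulli_pmf (\<Theta> $$ (i, j)))"
proof -
  have "map_pmf (\<lambda>A. A $$ (i, j)) (random_graph n \<Theta>) =
          map_pmf of_bool (map_pmf (\<lambda>e. e (i, j))
            (Pi_pmf (edge_slots n) False (\<lambda>(i, j). bernoulli_pmf (\<Theta> $$ (i, j)))))"
    using assms by (simp add: random_graph_def pmf.map_comp o_def adjacency_of_edges_index)
  also have "map_pmf (\<lambda>e. e (i, j))
      (Pi_pmf (edge_slots n) False (\<lambda>(i, j). bernoulli_pmf (\<Theta> $$ (i, j)))) =
      bernoulli_pmf (\<Theta> $$ (i, j))"
    using assms by (subst Pi_pmf_component) (auto simp: finite_edge_slots)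
  finally show ?thesis .
qed

lemma indep_vars_map_pmf:
  assumes "prob_space.indep_vars (measure_pmf p) (\<lambda>_. count_space UNIV) (\<lambda>i x. X i (f x)) I"
  shows "prob_space.indep_vars (measure_pmf (map_pmf f p)) (\<lambda>_. count_space UNIV) X I"
proof -
  have *: "measure (measure_pmf p) (\<Inter>j\<in>J. f -` A j) = (\<Prod>j\<in>J. measure (measure_pmf p) (f -` A j))"
    if J: "J \<subseteq> I" "J \<noteq> {}" "finite J" and A: "\<forall>j\<in>J. \<exists>B. A j = X j -` B" for J A
  proof -
    have "\<forall>j\<in>J. \<exists>B. f -` A j = (\<lambda>x. X j (f x)) -` B"
      using A by (force simp: vimage_def)
    thus ?thesis
      using assms J
      unfolding prob_space.indep_vars_def2[OF measure_pmf.prob_space_axioms]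
        prob_space.indep_sets_def[OF measure_pmf.prob_space_axioms]
      by (auto simp: Pi_iff)
  qed
  show ?thesis
    unfolding prob_space.indep_vars_def2[OF measure_pmf.prob_space_axioms]
      prob_space.indep_sets_def[OF measure_pmf.prob_space_axioms]
    by (auto simp: vimage_INT Pi_iff intro!: *)
qed

lemma indep_random_graph_entries:
  "prob_space.indep_vars (measure_pmf (random_graph n \<Theta>)) (\<lambda>_. count_space UNIV)
     (\<lambda>(i, j) A. A $$ (i, j)) (edge_slots n)"
proof -
  let ?P = "Pi_pmf (edge_slots n) False (\<lambda>(i, j). bernoulli_pmf (\<Theta> $$ (i, j)))"
  have "prob_space.indep_vars (measure_pmf ?P) (\<lambda>_. count_space UNIV) (\<lambda>x e. e x) (edge_slots n)"
    by (rule indep_vars_Pi_pmf) (rule finite_edge_slots)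
  hence "prob_space.indep_vars (measure_pmf ?P) (\<lambda>_. count_space UNIV)
           (\<lambda>x e. of_bool (e x) :: real) (edge_slots n)"
    by (rule prob_space.indep_vars_compose2[OF measure_pmf.prob_space_axioms]) auto
  also have "?this \<longleftrightarrow> prob_space.indep_vars (measure_pmf ?P) (\<lambda>_. count_space UNIV)
           (\<lambda>x e. (case x of (i, j) \<Rightarrow> \<lambda>A. A $$ (i, j)) (adjacency_of_edges n e)) (edge_slots n)"
    by (rule prob_space.indep_vars_cong[OF measure_pmf.prob_space_axioms])
       (auto simp: adjacency_of_edges_index fun_eq_iff)
  finally show ?thesis
    unfolding random_graph_def by (rule indep_vars_map_pmf)
qed

end

theory Submission
  imports Defs
begin

text \<open>
  Assouad's argument. Fix the labels of half of the vertices, say on \<open>F\<close>, and let those of the other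
  half \<open>U\<close> be arbitrary; the two connection probabilities are \<open>\<rho>/2\<close> and \<open>\<rho>/2 - \<delta>\<close> with
  \<open>\<delta>\<close> of order \<open>min (sqrt (\<rho>/n)) \<rho>\<close>. Testing the cut norm on the sets \<open>S \<times> F\<close> with \<open>S \<subseteq> U\<close>
  bounds it below by half the \<open>\<ell>\<^sub>1\<close> norm of the vector of row sums over \<open>F\<close>, which decouples the
  vertices of \<open>U\<close>. Flipping one label changes fewer than \<open>n\<close> edge probabilities, each at
  squared Hellinger distance at most \<open>\<delta>\<^sup>2/\<rho> \<le> 1/(4n)\<close>, so the two laws overlap by a constant and
  every row sum is misestimated by a constant multiple of \<open>|F| \<delta>\<close> on average over the labellings.
\<close>

section \<open>Cut norm and row sums\<close>

text \<open>There is no cancellation among the nonnegative terms, nor among the negative ones, and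
  one of these two groups carries at least half of the total absolute mass.\<close>

lemma exists_subset_half_sum_abs:
  fixes y :: "'a \<Rightarrow> real"
  assumes "finite U"
  obtains S where "S \<subseteq> U" "(\<Sum>i\<in>U. \<bar>y i\<bar>) / 2 \<le> \<bar>\<Sum>i\<in>S. y i\<bar>"
proof -
  define P N where "P = {i \<in> U. y i \<ge> 0}" and "N = {i \<in> U. y i < 0}"
  have split: "U = P \<union> N" "P \<inter> N = {}" "finite P" "finite N"
    using assms by (auto simp: P_def N_def)
  have "(\<Sum>i\<in>U. \<bar>y i\<bar>) = (\<Sum>i\<in>P. \<bar>y i\<bar>) + (\<Sum>i\<in>N. \<bar>y i\<bar>)"
    using split by (simp add: sum.union_disjoint)
  also have "(\<Sum>i\<in>P. \<bar>y i\<bar>) = (\<Sum>i\<in>P. y i)"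
    by (intro sum.cong) (auto simp: P_def)
  also have "(\<Sum>i\<in>N. \<bar>y i\<bar>) = - (\<Sum>i\<in>N. y i)"
    unfolding sum_negf[symmetric] by (intro sum.cong) (auto simp: N_def)
  finally have "(\<Sum>i\<in>U. \<bar>y i\<bar>) / 2 \<le> \<bar>\<Sum>i\<in>P. y i\<bar> \<or> (\<Sum>i\<in>U. \<bar>y i\<bar>) / 2 \<le> \<bar>\<Sum>i\<in>N. y i\<bar>"
    by linarith
  moreover have "P \<subseteq> U" "N \<subseteq> U" by (auto simp: P_def N_def)
  ultimately show ?thesis using that by blast
qed

lemma cut_norm_ge:
  assumes "S \<subseteq> {..<n}" "T \<subseteq> {..<n}"
  shows "\<bar>\<Sum>i\<in>S. \<Sum>j\<in>T. B $$ (i, j)\<bar> / (real n)\<^sup>2 \<le> cut_norm n B"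
proof -
  have "\<bar>\<Sum>i\<in>S. \<Sum>j\<in>T. B $$ (i, j)\<bar>
      \<le> Max ((\<lambda>(S, T). \<bar>\<Sum>i\<in>S. \<Sum>j\<in>T. B $$ (i, j)\<bar>) ` (Pow {..<n} \<times> Pow {..<n}))"
    using assms by (intro Max_ge) (auto intro!: image_eqI[of _ _ "(S, T)"])
  thus ?thesis
    unfolding cut_norm_def by (simp add: divide_right_mono)
qed

text \<open>With the columns fixed to \<open>F\<close>, the rows are selected by the sign of their
  sums over \<open>F\<close>. The factor 2 pays for replacing a maximum over cuts by a sum in which
  each vertex of \<open>U\<close> can be treated on its own.\<close>

lemma cut_norm_ge_row_sums:
  assumes "U \<subseteq> {..<n}" "F \<subseteq> {..<n}"
  shows "(\<Sum>i\<in>U. \<bar>\<Sum>j\<in>F. B $$ (i, j)\<bar>) / (2 * (real n)\<^sup>2) \<le> cut_norm n B"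
proof -
  have "finite U" using assms(1) finite_subset by blast
  then obtain S where S: "S \<subseteq> U"
    "(\<Sum>i\<in>U. \<bar>\<Sum>j\<in>F. B $$ (i, j)\<bar>) / 2 \<le> \<bar>\<Sum>i\<in>S. \<Sum>j\<in>F. B $$ (i, j)\<bar>"
    by (rule exists_subset_half_sum_abs)
  have "(\<Sum>i\<in>U. \<bar>\<Sum>j\<in>F. B $$ (i, j)\<bar>) / 2 / (real n)\<^sup>2
      \<le> \<bar>\<Sum>i\<in>S. \<Sum>j\<in>F. B $$ (i, j)\<bar> / (real n)\<^sup>2"
    by (rule divide_right_mono[OF S(2)]) simp
  also have "\<dots> \<le> cut_norm n B"
    using S(1) assms by (intro cut_norm_ge) auto
  finally show ?thesis by simp
qed

section \<open>Overlap and Hellinger affinity of two laws\<close>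

text \<open>Since \<open>P x * Q x\<close> is the product of the minimum and the maximum of the two,
  Cauchy-Schwarz separates these factors, and the maxima sum to at most 2.\<close>

lemma bhattacharyya_le_sum_min:
  fixes P Q :: "'a \<Rightarrow> real"
  assumes P: "\<And>x. x \<in> X \<Longrightarrow> 0 \<le> P x" "(\<Sum>x\<in>X. P x) \<le> 1"
    and Q: "\<And>x. x \<in> X \<Longrightarrow> 0 \<le> Q x" "(\<Sum>x\<in>X. Q x) \<le> 1"
  shows "(\<Sum>x\<in>X. sqrt (P x * Q x))\<^sup>2 \<le> 2 * (\<Sum>x\<in>X. min (P x) (Q x))"
proof -
  have "(\<Sum>x\<in>X. sqrt (P x * Q x)) = (\<Sum>x\<in>X. sqrt (min (P x) (Q x)) * sqrt (max (P x) (Q x)))"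
    by (intro sum.cong) (auto simp: real_sqrt_mult min_def max_def)
  hence "(\<Sum>x\<in>X. sqrt (P x * Q x))\<^sup>2
      \<le> (\<Sum>x\<in>X. (sqrt (min (P x) (Q x)))\<^sup>2) * (\<Sum>x\<in>X. (sqrt (max (P x) (Q x)))\<^sup>2)"
    using Cauchy_Schwarz_ineq_sum by metis
  also have "\<dots> = (\<Sum>x\<in>X. min (P x) (Q x)) * (\<Sum>x\<in>X. max (P x) (Q x))"
    using P(1) Q(1) by (intro arg_cong2[where f = "(*)"] sum.cong) (auto simp: le_max_iff_disj)
  also have "\<dots> \<le> (\<Sum>x\<in>X. min (P x) (Q x)) * 2"
  proof (rule mult_left_mono)
    have "(\<Sum>x\<in>X. max (P x) (Q x)) \<le> (\<Sum>x\<in>X. P x + Q x)"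
      using P(1) Q(1) by (intro sum_mono) auto
    thus "(\<Sum>x\<in>X. max (P x) (Q x)) \<le> 2"
      using P(2) Q(2) by (simp add: sum.distrib)
    show "0 \<le> (\<Sum>x\<in>X. min (P x) (Q x))"
      using P(1) Q(1) by (intro sum_nonneg) auto
  qed
  finally show ?thesis by simp
qed

text \<open>Le Cam's two-point bound: on the mass common to both laws the estimate
  \<open>f x\<close> is the same, so by the triangle inequality its two errors add up to at least
  the distance of the targets.\<close>

lemma two_point_risk:
  fixes P Q :: "'a \<Rightarrow> real"
  assumes "\<And>x. x \<in> X \<Longrightarrow> 0 \<le> P x" "\<And>x. x \<in> X \<Longrightarrow> 0 \<le> Q x"
  shows "\<bar>a - b\<bar> * (\<Sum>x\<in>X. min (P x) (Q x))
      \<le> (\<Sum>x\<in>X. \<bar>f x - a\<bar> * P x) + (\<Sum>x\<in>X. \<bar>f x - b\<bar> * Q x)"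
proof -
  have "\<bar>a - b\<bar> * min (P x) (Q x) \<le> \<bar>f x - a\<bar> * P x + \<bar>f x - b\<bar> * Q x" if "x \<in> X" for x
  proof -
    have "\<bar>a - b\<bar> * min (P x) (Q x) \<le> (\<bar>f x - a\<bar> + \<bar>f x - b\<bar>) * min (P x) (Q x)"
      using assms[OF that] by (intro mult_right_mono) auto
    also have "\<dots> = \<bar>f x - a\<bar> * min (P x) (Q x) + \<bar>f x - b\<bar> * min (P x) (Q x)"
      by (simp add: distrib_right)
    also have "\<dots> \<le> \<bar>f x - a\<bar> * P x + \<bar>f x - b\<bar> * Q x"
      by (intro add_mono mult_left_mono) auto
    finally show ?thesis .
  qed
  thus ?thesis
    unfolding sum_distrib_left sum.distrib[symmetric] by (intro sum_mono)
qed

lemma sqrt_prod: "sqrt (\<Prod>x\<in>A. f x) = (\<Prod>x\<in>A. sqrt (f x))"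
  by (induction A rule: infinite_finite_induct) (auto simp: real_sqrt_mult)

text \<open>The affinity is the expectation under \<open>P\<close> of the square root of the
  likelihood ratio, which factorizes over independent coordinates. Strict bounds on \<open>f\<close>
  keep the denominators positive; \<open>g\<close> may be degenerate.\<close>

lemma bhattacharyya_Pi_bernoulli:
  fixes f g :: "'a \<Rightarrow> real"
  assumes A: "finite A"
    and f: "\<And>x. x \<in> A \<Longrightarrow> 0 < f x \<and> f x < 1"
    and g: "\<And>x. x \<in> A \<Longrightarrow> 0 \<le> g x \<and> g x \<le> 1"
  defines "P \<equiv> Pi_pmf A False (\<lambda>x. bernoulli_pmf (f x))"
    and "Q \<equiv> Pi_pmf A False (\<lambda>x. bernoulli_pmf (g x))"
  shows "(\<Sum>e\<in>PiE_dflt A False (\<lambda>_. UNIV). sqrt (pmf P e * pmf Q e))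
      = (\<Prod>x\<in>A. sqrt (f x * g x) + sqrt ((1 - f x) * (1 - g x)))"
proof -
  let ?X = "PiE_dflt A False (\<lambda>_. UNIV :: bool set)"
  let ?r = "\<lambda>x b. sqrt (pmf (bernoulli_pmf (g x)) b / pmf (bernoulli_pmf (f x)) b)"
  have fin: "finite ?X" using A by (intro finite_PiE_dflt) auto
  have supp: "set_pmf P \<subseteq> ?X"
    unfolding P_def set_Pi_pmf[OF A] PiE_dflt_def by auto
  have pos: "pmf (bernoulli_pmf (f x)) b > 0" if "x \<in> A" for x b
    using f[OF that] by (cases b) auto
  have "sqrt (pmf P e * pmf Q e) = (\<Prod>x\<in>A. ?r x (e x)) * pmf P e" if "e \<in> ?X" for e
  proof -
    have "sqrt (pmf P e * pmf Q e)
        = (\<Prod>x\<in>A. sqrt (pmf (bernoulli_pmf (f x)) (e x) * pmf (bernoulli_pmf (g x)) (e x)))"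
      using that A by (auto simp: P_def Q_def pmf_Pi PiE_dflt_def prod.distrib[symmetric] sqrt_prod)
    also have "\<dots> = (\<Prod>x\<in>A. ?r x (e x) * pmf (bernoulli_pmf (f x)) (e x))"
    proof (rule prod.cong[OF refl])
      fix x assume "x \<in> A"
      define u v where "u = pmf (bernoulli_pmf (f x)) (e x)" and "v = pmf (bernoulli_pmf (g x)) (e x)"
      have "u > 0" using pos[OF \<open>x \<in> A\<close>] by (simp add: u_def)
      hence "sqrt (u * v) = sqrt (v / u) * u"
        by (simp add: real_sqrt_mult real_sqrt_divide field_simps)
      thus "sqrt (pmf (bernoulli_pmf (f x)) (e x) * pmf (bernoulli_pmf (g x)) (e x))
          = ?r x (e x) * pmf (bernoulli_pmf (f x)) (e x)"
        by (simp add: u_def v_def)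
    qed
    also have "\<dots> = (\<Prod>x\<in>A. ?r x (e x)) * pmf P e"
      using that A by (auto simp: P_def pmf_Pi PiE_dflt_def prod.distrib)
    finally show ?thesis .
  qed
  hence "(\<Sum>e\<in>?X. sqrt (pmf P e * pmf Q e)) = (\<Sum>e\<in>?X. (\<Prod>x\<in>A. ?r x (e x)) * pmf P e)"
    by (intro sum.cong) auto
  also have "\<dots> = measure_pmf.expectation P (\<lambda>e. \<Prod>x\<in>A. ?r x (e x))"
    using supp by (subst integral_measure_pmf_real[OF fin]) auto
  also have "\<dots> = (\<Prod>x\<in>A. measure_pmf.expectation (bernoulli_pmf (f x)) (?r x))"
    unfolding P_def using A by (intro expectation_prod_Pi_pmf integrable_measure_pmf_finite) auto
  also have "\<dots> = (\<Prod>x\<in>A. sqrt (f x * g x) + sqrt ((1 - f x) * (1 - g x)))"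
  proof (rule prod.cong[OF refl])
    fix x assume x: "x \<in> A"
    have *: "sqrt (v / u) * u = sqrt (u * v)" if "u > 0" for u v :: real
      using that by (simp add: real_sqrt_mult real_sqrt_divide field_simps)
    show "measure_pmf.expectation (bernoulli_pmf (f x)) (?r x)
        = sqrt (f x * g x) + sqrt ((1 - f x) * (1 - g x))"
      using f[OF x] g[OF x] *[of "f x" "g x"] *[of "1 - f x" "1 - g x"]
      by (simp add: mult.commute)
  qed
  finally show ?thesis .
qed

text \<open>Twice the affinity is 2 minus the squared differences of the roots of \<open>p\<close>,
  \<open>q\<close> and of \<open>1 - p\<close>, \<open>1 - q\<close>. Each is
  \<open>(p - q)\<^sup>2\<close> over a squared sum of roots, and that denominator is at least
  \<rho> because all four numbers are at least \<rho>/4.\<close>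

lemma bernoulli_affinity_ge:
  fixes p q \<rho> :: real
  assumes "0 < \<rho>" "\<rho> \<le> 1" "p \<in> {\<rho>/4..\<rho>/2}" "q \<in> {\<rho>/4..\<rho>/2}"
  shows "1 - (p - q)\<^sup>2 / \<rho> \<le> sqrt (p * q) + sqrt ((1 - p) * (1 - q))"
proof -
  have diff: "(sqrt a - sqrt b)\<^sup>2 \<le> (p - q)\<^sup>2 / \<rho>"
    if "a \<ge> \<rho>/4" "b \<ge> \<rho>/4" "(a - b)\<^sup>2 = (p - q)\<^sup>2" for a b :: real
  proof -
    have ab: "a > 0" "b > 0" using that assms(1) by auto
    have "\<rho> = (sqrt (\<rho>/4) + sqrt (\<rho>/4))\<^sup>2"
      using assms(1) by (simp add: power2_eq_square real_sqrt_divide field_simps)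
    also have "\<dots> \<le> (sqrt a + sqrt b)\<^sup>2"
      using that assms(1) by (intro power_mono add_mono real_sqrt_le_mono) auto
    finally have "(sqrt a - sqrt b)\<^sup>2 * \<rho> \<le> (sqrt a - sqrt b)\<^sup>2 * (sqrt a + sqrt b)\<^sup>2"
      by (intro mult_left_mono) auto
    also have "\<dots> = ((sqrt a)\<^sup>2 - (sqrt b)\<^sup>2)\<^sup>2"
      by (simp add: power_mult_distrib[symmetric] power2_eq_square algebra_simps)
    also have "\<dots> = (p - q)\<^sup>2" using that ab by simp
    finally show ?thesis using assms(1) by (simp add: field_simps)
  qed
  have expand: "(sqrt a - sqrt b)\<^sup>2 = a + b - 2 * sqrt (a * b)" if "a \<ge> 0" "b \<ge> 0" for a b :: real
    using that by (simp add: power2_diff real_sqrt_mult)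
  have "(sqrt p - sqrt q)\<^sup>2 \<le> (p - q)\<^sup>2 / \<rho>"
    using assms by (intro diff) auto
  moreover have "(sqrt (1 - p) - sqrt (1 - q))\<^sup>2 \<le> (p - q)\<^sup>2 / \<rho>"
    using assms by (intro diff) (auto simp: power2_commute)
  ultimately show ?thesis
    using expand[of p q] expand[of "1 - p" "1 - q"] assms by auto
qed

section \<open>The two-block family and its edge laws\<close>

text \<open>A labelling is encoded by the set of vertices with label 1. Complementing
  \<open>W\<close> gives the same matrix; fixing the labels of some vertices removes this
  ambiguity.\<close>

definition two_block_matrix :: "nat \<Rightarrow> real \<Rightarrow> real \<Rightarrow> nat set \<Rightarrow> real mat" where
  "two_block_matrix n p q W =
     mat n n (\<lambda>(i, j). if i = j then 0 else if (i \<in> W) = (j \<in> W) then p else q)"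

lemma two_block_matrix_sparse:
  assumes "n > 0" "p \<in> {0..\<rho>}" "q \<in> {0..\<rho>}" "\<rho> \<le> 1"
  shows "two_block_matrix n p q W \<in> sparse_block_matrices n 2 \<rho>"
proof -
  let ?z = "\<lambda>i. if i \<in> W then 1 else 0 :: nat"
  let ?Q = "mat 2 2 (\<lambda>(a, b). if a = b then p else q)"
  have "two_block_matrix n p q W \<in> block_matrices n 2"
    unfolding block_matrices_def two_block_matrix_def using assms
    by (auto intro!: bexI[of _ ?z] bexI[of _ ?Q] eq_matI)
  moreover have "max_norm n (two_block_matrix n p q W) \<le> \<rho>"
    unfolding max_norm_def two_block_matrix_def using assms
    by (subst Max_le_iff) auto
  ultimately show ?thesis by (simp add: sparse_block_matrices_def)
qed

lemma card_edge_slots_at_le: "card {s \<in> edge_slots n. fst s = i \<or> snd s = i} \<le> n"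
proof (rule surj_card_le[of "{..<n}", simplified])
  show "{s \<in> edge_slots n. fst s = i \<or> snd s = i} \<subseteq> (\<lambda>j. (min i j, max i j)) ` {..<n}"
  proof
    fix s assume "s \<in> {s \<in> edge_slots n. fst s = i \<or> snd s = i}"
    then obtain a b where "s = (a, b)" "a < b" "b < n" "a = i \<or> b = i"
      by (auto simp: edge_slots_def)
    thus "s \<in> (\<lambda>j. (min i j, max i j)) ` {..<n}"
      by (auto simp: image_iff intro!: bexI[of _ "if a = i then b else a"])
  qed
qed

text \<open>Edge configurations, unlike matrices, display the product structure of the law, and
  expectations become finite sums over \<open>edge_sets\<close>.\<close>

abbreviation edge_law :: "nat \<Rightarrow> real mat \<Rightarrow> (nat \<times> nat \<Rightarrow> bool) pmf" where
  "edge_law n \<Theta> \<equiv> Pi_pmf (edge_slots n) False (\<lambda>s. bernoulli_pmf (\<Theta> $$ s))"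

abbreviation edge_sets :: "nat \<Rightarrow> (nat \<times> nat \<Rightarrow> bool) set" where
  "edge_sets n \<equiv> PiE_dflt (edge_slots n) False (\<lambda>_. UNIV)"

lemma finite_edge_sets: "finite (edge_sets n)"
  by (intro finite_PiE_dflt finite_edge_slots) auto

lemma set_edge_law: "set_pmf (edge_law n \<Theta>) \<subseteq> edge_sets n"
  unfolding set_Pi_pmf[OF finite_edge_slots] PiE_dflt_def by auto

lemma sum_pmf_edge_law: "(\<Sum>e\<in>edge_sets n. pmf (edge_law n \<Theta>) e) = 1"
  by (rule sum_pmf_eq_1[OF finite_edge_sets set_edge_law])

lemma expectation_random_graph:
  "measure_pmf.expectation (random_graph n \<Theta>) h
     = (\<Sum>e\<in>edge_sets n. h (adjacency_of_edges n e) * pmf (edge_law n \<Theta>) e)"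
proof -
  have "(\<lambda>(i, j). bernoulli_pmf (\<Theta> $$ (i, j))) = (\<lambda>s. bernoulli_pmf (\<Theta> $$ s))"
    by auto
  hence "random_graph n \<Theta> = map_pmf (adjacency_of_edges n) (edge_law n \<Theta>)"
    by (simp add: random_graph_def)
  thus ?thesis
    using set_edge_law
    by (simp, subst integral_measure_pmf_real[OF finite_edge_sets]) auto
qed

text \<open>Only slots at \<open>i\<close> can change their parameter, and there are at most
  \<open>n\<close> of them, so the affinity is at least \<open>(1 - 1 / (4 * n)) ^ n\<close>, hence
  at least 3/4 by Bernoulli's inequality.\<close>

lemma flip_overlap:
  fixes \<rho> p q :: real
  assumes n: "n > 0" and \<rho>: "0 < \<rho>" "\<rho> \<le> 1"
    and pq: "p \<in> {\<rho>/4..\<rho>/2}" "q \<in> {\<rho>/4..\<rho>/2}" "(p - q)\<^sup>2 / \<rho> \<le> 1 / (4 * real n)"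
    and W: "W - {i} = W' - {i}"
  shows "1 / 4 \<le> (\<Sum>e\<in>edge_sets n. min (pmf (edge_law n (two_block_matrix n p q W)) e)
                                       (pmf (edge_law n (two_block_matrix n p q W')) e))"
proof -
  let ?M = "two_block_matrix n p q W" and ?M' = "two_block_matrix n p q W'"
  let ?P = "edge_law n ?M" and ?P' = "edge_law n ?M'"
  let ?D = "{s \<in> edge_slots n. fst s = i \<or> snd s = i}"
  define BC where "BC = (\<lambda>s. sqrt (?M $$ s * ?M' $$ s) + sqrt ((1 - ?M $$ s) * (1 - ?M' $$ s)))"
  have entry: "two_block_matrix n p q V $$ s = p \<or> two_block_matrix n p q V $$ s = q"
    if "s \<in> edge_slots n" for V s
    using that by (auto simp: edge_slots_def two_block_matrix_def)
  have range: "two_block_matrix n p q V $$ s \<in> {\<rho>/4..\<rho>/2}" if "s \<in> edge_slots n" for V s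
    using entry[OF that, of V] pq by auto
  have small: "1 - 1 / (4 * real n) \<le> BC s" if "s \<in> edge_slots n" for s
  proof -
    have "(?M $$ s - ?M' $$ s)\<^sup>2 \<le> (p - q)\<^sup>2"
      using entry[OF that, of W] entry[OF that, of W'] by (auto simp: power2_commute)
    hence "(?M $$ s - ?M' $$ s)\<^sup>2 / \<rho> \<le> (p - q)\<^sup>2 / \<rho>"
      using \<rho> by (intro divide_right_mono) auto
    moreover have "1 - (?M $$ s - ?M' $$ s)\<^sup>2 / \<rho> \<le> BC s"
      unfolding BC_def by (intro bernoulli_affinity_ge \<rho> range that)
    ultimately show ?thesis using pq(3) by linarith
  qed
  have one: "BC s = 1" if s: "s \<in> edge_slots n - ?D" for s
  proof -
    have "fst s \<noteq> i" "snd s \<noteq> i"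
      using s by auto
    hence "fst s \<in> W' \<longleftrightarrow> fst s \<in> W" "snd s \<in> W' \<longleftrightarrow> snd s \<in> W"
      using W by blast+
    hence "?M' $$ s = ?M $$ s"
      using s by (auto simp: edge_slots_def two_block_matrix_def)
    \<comment> \<open>For equal parameters \<open>p\<close> in [0, 1] the affinity is
      \<open>p + (1 - p)\<close>.\<close>
    thus ?thesis
      using range[of s W] s \<rho> by (auto simp: BC_def)
  qed
  have "3 / 4 = 1 + real n * (- (1 / (4 * real n)))"
    using n by simp
  also have "\<dots> \<le> (1 + (- (1 / (4 * real n)))) ^ n"
    using n by (intro Bernoulli_inequality) (simp add: field_simps)
  also have "\<dots> \<le> (1 - 1 / (4 * real n)) ^ card ?D"
    unfolding add_uminus_conv_diff using n
    by (intro power_decreasing card_edge_slots_at_le) (auto simp: field_simps)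
  also have "\<dots> = (\<Prod>s\<in>?D. 1 - 1 / (4 * real n))" by simp
  also have "\<dots> \<le> (\<Prod>s\<in>?D. BC s)"
    using small n by (intro prod_mono) (auto simp: field_simps)
  also have "\<dots> = (\<Prod>s\<in>edge_slots n. BC s)"
    using one finite_edge_slots by (intro prod.mono_neutral_left) auto
  also have "\<dots> = (\<Sum>e\<in>edge_sets n. sqrt (pmf ?P e * pmf ?P' e))"
  proof -
    have "0 < two_block_matrix n p q V $$ s \<and> two_block_matrix n p q V $$ s < 1"
      if "s \<in> edge_slots n" for V s
      using range[OF that, of V] \<rho> by auto
    thus ?thesis
      unfolding BC_def
      by (intro bhattacharyya_Pi_bernoulli[OF finite_edge_slots, symmetric]) (auto intro: less_imp_le)
  qed
  finally have "(3 / 4)\<^sup>2 \<le> (\<Sum>e\<in>edge_sets n. sqrt (pmf ?P e * pmf ?P' e))\<^sup>2"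
    by (intro power_mono) auto
  also have "\<dots> \<le> 2 * (\<Sum>e\<in>edge_sets n. min (pmf ?P e) (pmf ?P' e))"
    by (intro bhattacharyya_le_sum_min) (auto simp: sum_pmf_edge_law)
  \<comment> \<open>The overlap is at least 9/32, which exceeds 1/4.\<close>
  finally show ?thesis by (simp add: power2_eq_square)
qed

section \<open>Averaging over labellings\<close>

text \<open>Toggling the membership of \<open>i\<close> is an involution of
  \<open>Pow U\<close>.\<close>

lemma sum_flip_eq:
  fixes r :: "'a set \<Rightarrow> real"
  assumes "i \<in> U"
  shows "(\<Sum>W\<in>Pow U. r (sym_diff W {i})) = (\<Sum>W\<in>Pow U. r W)"
  using assms
  by (intro sum.reindex_bij_witness[of _ "\<lambda>W. sym_diff W {i}" "\<lambda>W. sym_diff W {i}"]) auto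

lemma exists_hard_labelling:
  fixes \<rho> \<delta> :: real
  assumes n: "n \<ge> 2" and \<rho>: "0 < \<rho>" "\<rho> \<le> 1"
    and \<delta>: "0 \<le> \<delta>" "\<delta> \<le> \<rho> / 4" "\<delta>\<^sup>2 / \<rho> \<le> 1 / (4 * real n)"
  obtains W where "\<delta> / 96 \<le> measure_pmf.expectation
      (random_graph n (two_block_matrix n (\<rho>/2) (\<rho>/2 - \<delta>) W))
      (\<lambda>A. cut_norm n (est A - two_block_matrix n (\<rho>/2) (\<rho>/2 - \<delta>) W))"
proof -
  define M where "M = two_block_matrix n (\<rho>/2) (\<rho>/2 - \<delta>)"
  define U F where "U = {..<n div 2}" and "F = {n div 2..<n}"
  \<comment> \<open>\<open>X\<close> is the estimated row sum over \<open>F\<close>,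
    \<open>\<theta>\<close> the true one when \<open>W \<subseteq> U\<close> and
    \<open>i \<in> U\<close>, \<open>r\<close> the resulting absolute risk and \<open>R\<close> the
    cut norm risk.\<close>
  define X where "X = (\<lambda>i e. \<Sum>j\<in>F. est (adjacency_of_edges n e) $$ (i, j))"
  define \<theta> where "\<theta> = (\<lambda>(i :: nat) W. real (card F) * (if i \<in> W then \<rho>/2 - \<delta> else \<rho>/2))"
  define r where "r = (\<lambda>i W. \<Sum>e\<in>edge_sets n. \<bar>X i e - \<theta> i W\<bar> * pmf (edge_law n (M W)) e)"
  define R where "R = (\<lambda>W. measure_pmf.expectation (random_graph n (M W)) (\<lambda>A. cut_norm n (est A - M W)))"
  have cards: "card U = n div 2" "card F = n - n div 2"
    by (auto simp: U_def F_def)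
  have R_ge: "(\<Sum>i\<in>U. r i W) / (2 * (real n)\<^sup>2) \<le> R W" if W: "W \<subseteq> U" for W
  proof -
    have *: "(\<Sum>i\<in>U. \<bar>X i e - \<theta> i W\<bar>) / (2 * (real n)\<^sup>2)
        \<le> cut_norm n (est (adjacency_of_edges n e) - M W)" for e
    proof -
      have "(\<Sum>j\<in>F. (est (adjacency_of_edges n e) - M W) $$ (i, j)) = X i e - \<theta> i W"
        if i: "i \<in> U" for i
      proof -
        have "(est (adjacency_of_edges n e) - M W) $$ (i, j)
            = est (adjacency_of_edges n e) $$ (i, j) - (if i \<in> W then \<rho>/2 - \<delta> else \<rho>/2)"
          if "j \<in> F" for j
        proof -
          \<comment> \<open>All of \<open>F\<close> has label 0, so the entry depends on the label
            of \<open>i\<close> alone; disjointness of \<open>U\<close> and \<open>F\<close> avoids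
            the zero diagonal.\<close>
          have "j \<notin> W" "i \<noteq> j" "i < n" "j < n"
            using that i W by (auto simp: U_def F_def)
          thus ?thesis by (simp add: M_def two_block_matrix_def)
        qed
        thus ?thesis by (simp add: X_def \<theta>_def sum_subtractf)
      qed
      hence "(\<Sum>i\<in>U. \<bar>X i e - \<theta> i W\<bar>)
          = (\<Sum>i\<in>U. \<bar>\<Sum>j\<in>F. (est (adjacency_of_edges n e) - M W) $$ (i, j)\<bar>)"
        by simp
      moreover have "U \<subseteq> {..<n}" "F \<subseteq> {..<n}"
        by (auto simp: U_def F_def)
      ultimately show ?thesis
        using cut_norm_ge_row_sums[of U n F "est (adjacency_of_edges n e) - M W"] by simp
    qed
    have "(\<Sum>i\<in>U. r i W) / (2 * (real n)\<^sup>2)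
        = (\<Sum>e\<in>edge_sets n. (\<Sum>i\<in>U. \<bar>X i e - \<theta> i W\<bar>) / (2 * (real n)\<^sup>2) * pmf (edge_law n (M W)) e)"
      unfolding r_def
      by (subst sum.swap) (simp add: sum_divide_distrib sum_distrib_right)
    also have "\<dots> \<le> (\<Sum>e\<in>edge_sets n. cut_norm n (est (adjacency_of_edges n e) - M W)
                                     * pmf (edge_law n (M W)) e)"
      by (intro sum_mono mult_right_mono *) auto
    finally show ?thesis by (simp add: R_def expectation_random_graph)
  qed
  \<comment> \<open>The flip moves \<open>\<theta>\<close> by \<open>card F * \<delta>\<close>, and
    at least a quarter of the mass is common to both laws.\<close>
  have pair: "card F * \<delta> / 4 \<le> r i W + r i (sym_diff W {i})" for i W
  proof -
    let ?W' = "sym_diff W {i}"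
    have "\<theta> i W - \<theta> i ?W' = card F * \<delta> \<or> \<theta> i W - \<theta> i ?W' = - (card F * \<delta>)"
      by (auto simp: \<theta>_def algebra_simps)
    hence "\<bar>\<theta> i W - \<theta> i ?W'\<bar> = card F * \<delta>"
      using \<delta>(1) by (auto simp: abs_mult)
    moreover have "1 / 4 \<le> (\<Sum>e\<in>edge_sets n. min (pmf (edge_law n (M W)) e)
                                                (pmf (edge_law n (M ?W')) e))"
      unfolding M_def using n \<rho> \<delta> by (intro flip_overlap[where \<rho> = \<rho> and i = i]) auto
    hence "card F * \<delta> * (1 / 4) \<le> card F * \<delta> * \<dots>"
      using \<delta>(1) by (intro mult_left_mono) auto
    moreover have "\<bar>\<theta> i W - \<theta> i ?W'\<bar> * (\<Sum>e\<in>edge_sets n. min (pmf (edge_law n (M W)) e)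
                                                (pmf (edge_law n (M ?W')) e))
        \<le> r i W + r i ?W'"
      unfolding r_def by (intro two_point_risk) auto
    ultimately show ?thesis by simp
  qed
  have sum_r: "card (Pow U) * (card F * \<delta> / 8) \<le> (\<Sum>W\<in>Pow U. r i W)" if "i \<in> U" for i
  proof -
    have "card (Pow U) * (card F * \<delta> / 4) = (\<Sum>W\<in>Pow U. card F * \<delta> / 4)" by simp
    also have "\<dots> \<le> (\<Sum>W\<in>Pow U. r i W + r i (sym_diff W {i}))"
      by (intro sum_mono pair)
    also have "\<dots> = 2 * (\<Sum>W\<in>Pow U. r i W)"
      using sum_flip_eq[OF that, of "r i"] by (simp add: sum.distrib)
    finally show ?thesis by simp
  qed
  have "\<exists>W\<in>Pow U. \<delta> / 96 \<le> R W"
  \<comment> \<open>If every labelling had risk below \<delta>/96, so would their average, contrary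
    to the bound obtained by summing \<open>sum_r\<close> over \<open>U\<close>.\<close>
  proof (rule ccontr)
    assume "\<not> ?thesis"
    hence "(\<Sum>W\<in>Pow U. R W) < (\<Sum>W\<in>Pow U. \<delta> / 96)"
      by (intro sum_strict_mono) (auto simp: U_def not_le)
    moreover have "(\<Sum>W\<in>Pow U. \<delta> / 96) \<le> (\<Sum>W\<in>Pow U. R W)"
    proof -
      have "real n / 3 * (real n / 2) \<le> card U * card F"
      proof -
        \<comment> \<open>The factor 3 is sharp at \<open>n = 3\<close>. The constant is then 96 = 3
          * 2 * 8 * 2, with 8 from \<open>sum_r\<close> and the last 2 from the cut norm
          bound.\<close>
        have "n \<le> 3 * (n div 2)" "n \<le> 2 * (n - n div 2)"
          using n by linarith+
        hence "real n / 3 \<le> card U" "real n / 2 \<le> card F"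
          unfolding cards by linarith+
        thus ?thesis
          unfolding of_nat_mult by (intro mult_mono) auto
      qed
      hence "real n / 3 * (real n / 2) * (\<delta> / 8) \<le> card U * card F * (\<delta> / 8)"
        using \<delta>(1) by (intro mult_right_mono) auto
      hence "\<delta> / 96 \<le> card U * (card F * \<delta> / 8) / (2 * (real n)\<^sup>2)"
        using n by (simp add: field_simps power2_eq_square)
      hence "card (Pow U) * (\<delta> / 96) \<le> card (Pow U) * (card U * (card F * \<delta> / 8) / (2 * (real n)\<^sup>2))"
        by (intro mult_left_mono) auto
      hence "(\<Sum>W\<in>Pow U. \<delta> / 96)
          \<le> (\<Sum>i\<in>U. card (Pow U) * (card F * \<delta> / 8)) / (2 * (real n)\<^sup>2)"
        by (simp add: mult_ac)
      also have "\<dots> \<le> (\<Sum>i\<in>U. \<Sum>W\<in>Pow U. r i W) / (2 * (real n)\<^sup>2)"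
        by (intro divide_right_mono sum_mono sum_r) auto
      also have "\<dots> = (\<Sum>W\<in>Pow U. (\<Sum>i\<in>U. r i W) / (2 * (real n)\<^sup>2))"
        by (subst sum.swap) (simp add: sum_divide_distrib)
      also have "\<dots> \<le> (\<Sum>W\<in>Pow U. R W)"
        by (intro sum_mono R_ge) auto
      finally show ?thesis .
    qed
    ultimately show False by simp
  qed
  thus ?thesis using that by (auto simp: R_def M_def)
qed

theorem proposition3:
  shows "\<exists>C::real. C > 0 \<and>
    (\<forall>n::nat. \<forall>\<rho>::real. n \<ge> 2 \<and> 0 < \<rho> \<and> \<rho> \<le> 1 \<longrightarrow>
       minimax_cut_risk n (sparse_block_matrices n 2 \<rho>)
         \<ge> ereal (C * min (sqrt (\<rho> / real n)) \<rho>))"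
\<comment> \<open>384 = 4 * 96, with 4 from the choice of \<delta> and 96 from
  \<open>exists_hard_labelling\<close>.\<close>
proof (intro exI[of _ "1 / 384"] conjI allI impI)
  show "(1 / 384 :: real) > 0" by simp
next
  fix n :: nat and \<rho> :: real
  assume asm: "n \<ge> 2 \<and> 0 < \<rho> \<and> \<rho> \<le> 1"
  define m where "m = min (sqrt (\<rho> / real n)) \<rho>"
  \<comment> \<open>The quarter keeps \<open>\<rho>/2 - \<delta>\<close> above \<rho>/4 and gives
    \<open>\<delta>\<^sup>2 / \<rho> \<le> 1 / (16 * n)\<close>, within the margin 1/(4n).\<close>
  define \<delta> where "\<delta> = m / 4"
  have m: "0 \<le> m" "m \<le> \<rho>" "m \<le> sqrt (\<rho> / real n)"
    using asm by (auto simp: m_def)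
  have "m\<^sup>2 \<le> \<rho> / real n"
    using power_mono[OF m(3) m(1), of 2] asm by simp
  hence "m\<^sup>2 / \<rho> \<le> 1 / real n"
    using asm by (simp add: field_simps)
  hence \<delta>: "0 \<le> \<delta>" "\<delta> \<le> \<rho> / 4" "\<delta>\<^sup>2 / \<rho> \<le> 1 / (4 * real n)"
    using m asm by (auto simp: \<delta>_def power_divide field_simps)
  have "ereal (\<delta> / 96) \<le> (SUP \<Theta> \<in> sparse_block_matrices n 2 \<rho>.
      ereal (measure_pmf.expectation (random_graph n \<Theta>) (\<lambda>A. cut_norm n (est A - \<Theta>))))" for est
  proof -
    obtain W where W: "\<delta> / 96 \<le> measure_pmf.expectation
        (random_graph n (two_block_matrix n (\<rho>/2) (\<rho>/2 - \<delta>) W))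
        (\<lambda>A. cut_norm n (est A - two_block_matrix n (\<rho>/2) (\<rho>/2 - \<delta>) W))"
      using exists_hard_labelling[of n \<rho> \<delta>] asm \<delta> by blast
    show ?thesis
      using asm \<delta> W
      by (intro SUP_upper2[of "two_block_matrix n (\<rho>/2) (\<rho>/2 - \<delta>) W"] two_block_matrix_sparse) auto
  qed
  thus "ereal (1 / 384 * min (sqrt (\<rho> / real n)) \<rho>)
      \<le> minimax_cut_risk n (sparse_block_matrices n 2 \<rho>)"
    unfolding minimax_cut_risk_def by (intro INF_greatest) (simp add: \<delta>_def m_def)
qed

end
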